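(* Let $d^{\text{in}}, d^{\text{out}}, n, k$ be positive integers with $n\ge\max(d^{\text{in}},d^{\text{out}})$ and $1\le k\le\min(d^{\text{in}},d^{\text{out}})$, let $a,b>0$, let $\bm{W}\in\mathbb{R}^{d^{\text{out}}\times d^{\text{in}}}$, $\widehat{\bm{W}}\in\mathcal{C}(b)\cap\mathbb{R}^{d^{\text{out}}\times d^{\text{in}}}$ and $\bm{X}\in\mathbb{R}^{d^{\text{in}}\times n}$. Assume that $\bm{X}$ is full rank and let $\bm{Y}:=Q_a(\bm{X})$. Then the optimization problem $$\text{(P)}\qquad \min_{\bm{U}\in\mathbb{R}^{d^{\text{out}}\times k},\ \bm{V}\in\mathbb{R}^{d^{\text{in}}\times k}}\Vert\bm{W}\bm{X}-\widehat{\bm{W}}Q_a(\bm{X})-\bm{U}\bm{V}^\top\bm{X}\Vert_2^2$$ is equivalent (meaning: has the same solutions) to the optimization problem $$\text{(Q)}\qquad \max_{\bm{U}\in\mathbb{R}^{d^{\text{out}}\times k}\cap\mathcal{O},\ \bm{V}\in\mathbb{R}^{d^{\text{in}}\times k}}\operatorname{Tr}(\bm{U}^\top(\bm{\Sigma}_1+\bm{\Sigma}_2-\bm{\Sigma}_3)\bm{U})\quad\text{s.t.}\quad \bm{V}=\left[\bm{W}^\top-(\bm{X}\bm{X}^\top)^{-1}\bm{X}\bm{Y}^\top\widehat{\bm{W}}^\top\right]\bm{U},$$ where $$\bm{\Sigma}_1:=\bm{W}\bm{X}\bm{X}^\top\bm{W}^\top,\qquad \bm{\Sigma}_2:=\widehat{\bm{W}}\bm{Y}\bm{X}^\top(\bm{X}\bm{X}^\top)^{-1}\bm{X}\bm{Y}^\top\widehat{\bm{W}}^\top,$$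 $$\bm{\Sigma}_3:=\widehat{\bm{W}}\bm{Y}\bm{X}^\top\bm{W}^\top+\bm{W}\bm{X}\bm{Y}^\top\widehat{\bm{W}}^\top.$$ In addition, a solution can be obtained by defining $\bm{U}$ as the $k$ unit eigenvectors of $\bm{\Sigma}:=\bm{\Sigma}_1+\bm{\Sigma}_2-\bm{\Sigma}_3$ associated to its $k$ largest eigenvalues, and $\bm{V}=\left[\bm{W}^\top-(\bm{X}\bm{X}^\top)^{-1}\bm{X}\bm{Y}^\top\widehat{\bm{W}}^\top\right]\bm{U}$.
   Context: Two optimization problems are called equivalent if they have the same solutions. $\Vert\cdot\Vert_2$ applied to a matrix denotes the Frobenius norm (square root of the sum of squared entries). $\mathcal{O}$ denotes the set of matrices with orthonormal columns. For $b>0$, $\mathcal{C}(b)$ denotes the set of real matrices admitting a bit precision of $b$ bits per entry. For $a>0$, $Q_a$ is any quantization operator: a map sending each real matrix $\bm{Z}$ to a real matrix $Q_a(\bm{Z})$ of the same shape with $Q_a(\bm{Z})\in\mathcal{C}(a)$. The matrix $\widehat{\bm{W}}$ is the current quantized weight matrix, held fixed in this problem. A matrix of size $d^{\text{in}}\times n$ with $n\ge d^{\text{in}}$ is full rank if its rank is $d^{\text{in}}$. The $k$ unit eigenvectors forming the columns of $\bm{U}$ are taken orthonormal.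
   Formalization: "Same solutions" fails literally, since (2U, V/2) solves (P) whenever (U, V) does; proved instead: the solutions of (Q) are exactly those of (P) with U in O, and the solutions of (P) are exactly the pairs whose product UV^T equals that of a solution of (Q). *)

theory Defs
  imports
    "Jordan_Normal_Form.Char_Poly"
    "Jordan_Normal_Form.DL_Rank"
    "Jordan_Normal_Form.Gauss_Jordan_Elimination"
begin

definition frob_norm :: "real mat \<Rightarrow> real" where
  "frob_norm A = sqrt (\<Sum>i<dim_row A. \<Sum>j<dim_col A. (A $$ (i, j))\<^sup>2)"

definition trace_mat :: "real mat \<Rightarrow> real" where
  "trace_mat A = (\<Sum>i<dim_row A. A $$ (i, i))"

text \<open>Only meaningful for invertible matrices; otherwise the value is unspecified.\<close>

definition inv_mat :: "real mat \<Rightarrow> real mat" where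
  "inv_mat A = the (mat_inverse A)"

definition orthonormal_cols :: "real mat \<Rightarrow> bool" where
  "orthonormal_cols U \<longleftrightarrow>
     (\<forall>i<dim_col U. \<forall>j<dim_col U. col U i \<bullet> col U j = (if i = j then 1 else 0))"

text \<open>The family \<open>C\<close> assigns to a bit width \<open>a\<close> the set of real matrices (of all shapes) that admit
  a precision of \<open>a\<close> bits per entry. The number format is left unspecified, so \<open>C\<close> is a parameter.\<close>

definition quantization_operator ::
    "(real \<Rightarrow> real mat set) \<Rightarrow> real \<Rightarrow> (real mat \<Rightarrow> real mat) \<Rightarrow> bool" where
  "quantization_operator C a Q \<longleftrightarrow>
     (\<forall>Z. Q Z \<in> C a \<and> dim_row (Q Z) = dim_row Z \<and> dim_col (Q Z) = dim_col Z)"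

text \<open>The list \<open>es\<close> enumerates all eigenvalues of \<open>S\<close> with multiplicity, its first \<open>k\<close> entries being
  the \<open>k\<close> largest ones. It need not be sorted beyond that: the order of the columns of \<open>U\<close> is free.
  If the \<open>k\<close>-th and \<open>(k+1)\<close>-st largest eigenvalues coincide, any choice of eigenvectors is allowed.\<close>

definition top_eigenvectors :: "nat \<Rightarrow> real mat \<Rightarrow> real mat \<Rightarrow> bool" where
  "top_eigenvectors k S U \<longleftrightarrow>
     U \<in> carrier_mat (dim_row S) k \<and> orthonormal_cols U \<and>
     (\<exists>es. char_poly S = (\<Prod>e\<leftarrow>es. [:- e, 1:]) \<and> k \<le> length es \<and>
           (\<forall>i<k. \<forall>j. k \<le> j \<and> j < length es \<longrightarrow> es ! j \<le> es ! i) \<and>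
           (\<forall>j<k. eigenvector S (col U j) (es ! j)))"

end

theory Submission
  imports Defs "Jordan_Normal_Form.Schur_Decomposition"
begin

text \<open>
  Put \<open>H = (X X\<^sup>T)\<^sup>-\<^sup>1\<close> and \<open>A = W - What Y X\<^sup>T H\<close>. The residual
  \<open>E = W X - What Y - A X\<close> satisfies \<open>E X\<^sup>T = 0\<close>, so the objective of (P) equals
  \<open>|E|\<^sup>2 + |A X - U V\<^sup>T X|\<^sup>2\<close>. When \<open>U\<close> has orthonormal columns, a second application of Pythagoras
  turns this into \<open>c - Tr (U\<^sup>T \<Sigma> U) + |(U\<^sup>T A - V\<^sup>T) X|\<^sup>2\<close> with \<open>\<Sigma> = A X (A X)\<^sup>T\<close>, and the last term
  vanishes exactly for \<open>V = A\<^sup>T U\<close>. Gram-Schmidt rewrites any product \<open>U V\<^sup>T\<close> with an orthonormal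
  left factor, so minimising over all pairs amounts to maximising the trace, and Ky Fan's principle
  identifies the maximum with the sum of the \<open>k\<close> largest eigenvalues.
\<close>

section \<open>Trace and Frobenius norm\<close>

lemma trace_mat_mult:
  assumes "A \<in> carrier_mat n m" "B \<in> carrier_mat m n"
  shows "trace_mat (A * B) = (\<Sum>i<n. \<Sum>j<m. A $$ (i, j) * B $$ (j, i))"
  using assms by (auto simp: trace_mat_def scalar_prod_def lessThan_atLeast0 intro!: sum.cong)

lemma trace_mat_comm:
  assumes "A \<in> carrier_mat n m" "B \<in> carrier_mat m n"
  shows "trace_mat (A * B) = trace_mat (B * A)"
  unfolding trace_mat_mult[OF assms] trace_mat_mult[OF assms(2,1)]
  by (subst sum.swap) (simp add: mult.commute)

lemma trace_mat_transpose:
  assumes "A \<in> carrier_mat n n"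
  shows "trace_mat A\<^sup>T = trace_mat A"
  using assms by (simp add: trace_mat_def)

lemma trace_mat_add:
  assumes "A \<in> carrier_mat n n" "B \<in> carrier_mat n n"
  shows "trace_mat (A + B) = trace_mat A + trace_mat B"
  using assms by (auto simp: trace_mat_def sum.distrib)

lemma trace_mat_one: "trace_mat (1\<^sub>m n) = real n"
  by (simp add: trace_mat_def)

lemma frob_norm_sq:
  assumes "A \<in> carrier_mat n m"
  shows "(frob_norm A)\<^sup>2 = trace_mat (A * A\<^sup>T)"
proof -
  have "trace_mat (A * A\<^sup>T) = (\<Sum>i<n. \<Sum>j<m. (A $$ (i, j))\<^sup>2)"
    using assms by (subst trace_mat_mult[of _ n m]) (auto simp: power2_eq_square intro!: sum.cong)
  moreover have "0 \<le> (\<Sum>i<n. \<Sum>j<m. (A $$ (i, j))\<^sup>2)"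
    by (intro sum_nonneg) auto
  ultimately show ?thesis
    using assms by (simp add: frob_norm_def)
qed

lemma frob_norm_eq_0D:
  assumes "A \<in> carrier_mat n m" "(frob_norm A)\<^sup>2 = 0"
  shows "A = 0\<^sub>m n m"
proof -
  have *: "0 \<le> (\<Sum>j<m. (A $$ (i, j))\<^sup>2)" for i
    by (intro sum_nonneg) auto
  have "(\<Sum>i<n. \<Sum>j<m. (A $$ (i, j))\<^sup>2) = 0"
    using assms by (simp add: frob_norm_def)
  hence "\<forall>i<n. (\<Sum>j<m. (A $$ (i, j))\<^sup>2) = 0"
    by (subst (asm) sum_nonneg_eq_0_iff) (auto simp: *)
  hence "\<forall>i<n. \<forall>j<m. A $$ (i, j) = 0"
    by (subst (asm) sum_nonneg_eq_0_iff) auto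
  thus ?thesis
    using assms(1) by (intro eq_matI) auto
qed

lemma frob_norm_zero: "frob_norm (0\<^sub>m n m) = 0"
  by (simp add: frob_norm_def)

text \<open>The two cross terms are transposes of each other, so a single vanishing trace removes
  both.\<close>

lemma frob_norm_pythagoras:
  assumes A: "A \<in> carrier_mat n m" and B: "B \<in> carrier_mat n m"
    and orth: "trace_mat (A * B\<^sup>T) = 0"
  shows "(frob_norm (A + B))\<^sup>2 = (frob_norm A)\<^sup>2 + (frob_norm B)\<^sup>2"
proof -
  have "trace_mat (B * A\<^sup>T) = trace_mat ((A * B\<^sup>T)\<^sup>T)"
    using A B by (subst transpose_mult[of _ n m _ n]) auto
  hence orth': "trace_mat (B * A\<^sup>T) = 0"
    using A B orth by (subst (asm) trace_mat_transpose[of _ n]) auto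
  have "(A + B) * (A + B)\<^sup>T = (A * A\<^sup>T + B * A\<^sup>T) + (A * B\<^sup>T + B * B\<^sup>T)"
    using A B by (simp add: transpose_add[of _ n m] mult_add_distrib_mat[of _ n m _ n]
        add_mult_distrib_mat[of _ n m _ _ n])
  hence "trace_mat ((A + B) * (A + B)\<^sup>T) =
      trace_mat (A * A\<^sup>T) + trace_mat (B * A\<^sup>T) + (trace_mat (A * B\<^sup>T) + trace_mat (B * B\<^sup>T))"
    using A B by (simp add: trace_mat_add[of _ n])
  thus ?thesis
    using A B orth orth' by (simp add: frob_norm_sq[of _ n m])
qed

section \<open>Orthonormal columns as isometries, and projection onto their span\<close>

lemma orthonormal_cols_iff:
  assumes "U \<in> carrier_mat n k"
  shows "orthonormal_cols U \<longleftrightarrow> U\<^sup>T * U = 1\<^sub>m k"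
proof
  show "U\<^sup>T * U = 1\<^sub>m k" if "orthonormal_cols U"
    using that assms by (intro eq_matI) (auto simp: orthonormal_cols_def)
next
  assume *: "U\<^sup>T * U = 1\<^sub>m k"
  have "col U i \<bullet> col U j = (if i = j then 1 else 0)" if "i < k" "j < k" for i j
  proof -
    have "col U i \<bullet> col U j = (U\<^sup>T * U) $$ (i, j)"
      using that assms by simp
    thus ?thesis
      using that by (simp add: *)
  qed
  thus "orthonormal_cols U"
    using assms by (auto simp: orthonormal_cols_def)
qed

text \<open>Cyclicity of the trace moves the outer \<open>U\<close> next to
  \<open>U\<^sup>T\<close>, where both cancel.\<close>

lemma frob_norm_orthonormal_mult:
  assumes U: "U \<in> carrier_mat d k" and oU: "U\<^sup>T * U = 1\<^sub>m k" and M: "M \<in> carrier_mat k n"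
  shows "(frob_norm (U * M))\<^sup>2 = (frob_norm M)\<^sup>2"
proof -
  have "(frob_norm (U * M))\<^sup>2 = trace_mat (U * (M * (M\<^sup>T * U\<^sup>T)))"
    using U M by (simp add: frob_norm_sq[of _ d n] transpose_mult[of _ d k _ n]
        assoc_mult_mat[of _ d k _ n _ d])
  also have "\<dots> = trace_mat (M * (M\<^sup>T * U\<^sup>T) * U)"
    using U M by (intro trace_mat_comm[of _ d k]) auto
  also have "M * (M\<^sup>T * U\<^sup>T) * U = M * M\<^sup>T * (U\<^sup>T * U)"
    using U M by (simp add: assoc_mult_mat[of _ k n _ d _ k] assoc_mult_mat[of _ n k _ d _ k]
        assoc_mult_mat[of _ k n _ k _ k])
  also have "\<dots> = M * M\<^sup>T"
    using M by (simp add: oU)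
  finally show ?thesis
    using M by (simp add: frob_norm_sq[of _ k n])
qed

text \<open>Least squares against an orthonormal \<open>U\<close>: the minimiser in \<open>M\<close> is \<open>U\<^sup>T * N\<close>.\<close>

lemma frob_norm_minus_orthonormal:
  assumes U: "U \<in> carrier_mat d k" and oU: "U\<^sup>T * U = 1\<^sub>m k"
    and N: "N \<in> carrier_mat d n" and M: "M \<in> carrier_mat k n"
  shows "(frob_norm (N - U * M))\<^sup>2 =
    (frob_norm N)\<^sup>2 - (frob_norm (U\<^sup>T * N))\<^sup>2 + (frob_norm (U\<^sup>T * N - M))\<^sup>2"
proof -
  define T where "T = U\<^sup>T * N"
  \<comment> \<open>\<open>U * T\<close> projects the columns of \<open>N\<close> onto the column
    span of \<open>U\<close>; \<open>E\<close> is the orthogonal remainder.\<close>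
  define E where "E = N - U * T"
  have T: "T \<in> carrier_mat k n" and E: "E \<in> carrier_mat d n"
    using U N by (auto simp: T_def E_def)
  have "U\<^sup>T * (U * T) = U\<^sup>T * U * T"
    using U T by (intro assoc_mult_mat[symmetric]) auto
  hence UE: "U\<^sup>T * E = 0\<^sub>m k n"
    using U N T unfolding E_def
    by (subst mult_minus_distrib_mat[of _ k d _ n]) (auto simp: oU T_def[symmetric])
  \<comment> \<open>Used for \<open>Z = T\<close>, which gives the norm of \<open>N\<close>, and for
    \<open>Z = T - M\<close>, which gives the norm of \<open>N - U * M\<close>. Subtracting the two
    eliminates \<open>E\<close>.\<close>
  have *: "(frob_norm (E + U * Z))\<^sup>2 = (frob_norm E)\<^sup>2 + (frob_norm Z)\<^sup>2"
    if Z: "Z \<in> carrier_mat k n" for Z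
  proof -
    have "trace_mat (E * (U * Z)\<^sup>T) = trace_mat (E * Z\<^sup>T * U\<^sup>T)"
      using U E Z by (simp add: transpose_mult[of _ d k _ n] assoc_mult_mat[of _ d n _ k _ d])
    also have "\<dots> = trace_mat (U\<^sup>T * (E * Z\<^sup>T))"
      using U E Z by (intro trace_mat_comm[of _ d k]) auto
    also have "U\<^sup>T * (E * Z\<^sup>T) = U\<^sup>T * E * Z\<^sup>T"
      using U E Z by (simp add: assoc_mult_mat[of _ k d _ n _ k])
    also have "trace_mat \<dots> = 0"
      using Z by (simp add: UE trace_mat_def)
    finally show ?thesis
      using U E Z by (subst frob_norm_pythagoras[of _ d n]) (auto simp: frob_norm_orthonormal_mult[OF U oU Z])
  qed
  have "E + U * T = N"
    using U N T by (auto simp: E_def)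
  moreover have "E + U * (T - M) = N - U * M"
    using U N T M by (auto simp: E_def mult_minus_distrib_mat[OF U T M])
  ultimately show ?thesis
    using *[OF T] *[OF minus_carrier_mat[OF M, of T]] unfolding T_def[symmetric] by simp
qed

section \<open>Orthonormal columns\<close>

lemma mult_mat_unit_vec:
  fixes A :: "'a :: comm_ring_1 mat"
  assumes "A \<in> carrier_mat m n" "j < n"
  shows "A *\<^sub>v unit_vec n j = col A j"
  using assms by (intro eq_vecI) auto

text \<open>One Gram-Schmidt step that also succeeds when \<open>u\<close> already lies in the span
  of \<open>U\<close>: some other orthogonal direction, which exists because \<open>k < d\<close>,
  is then appended with coefficient zero. The vector \<open>w\<close> holds the coordinates of
  \<open>u\<close> in the extended system.\<close>

lemma orthonormal_extend:
  fixes U :: "real mat"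
  assumes U: "U \<in> carrier_mat d k" and oU: "U\<^sup>T * U = 1\<^sub>m k" and k: "k < d"
    and u: "u \<in> carrier_vec d"
  shows "\<exists>U' w. U' \<in> carrier_mat d (Suc k) \<and> U'\<^sup>T * U' = 1\<^sub>m (Suc k) \<and>
    (\<forall>j<k. col U' j = col U j) \<and> w \<in> carrier_vec (Suc k) \<and> u = U' *\<^sub>v w"
proof -
  \<comment> \<open>The component of \<open>x\<close> orthogonal to the columns of
    \<open>U\<close>.\<close>
  define res where "res = (\<lambda>x. x - U *\<^sub>v (U\<^sup>T *\<^sub>v x))"
  have res_carr: "res x \<in> carrier_vec d" if "x \<in> carrier_vec d" for x
    using U that by (auto simp: res_def)
  have res0: "U\<^sup>T *\<^sub>v res x = 0\<^sub>v k" if x: "x \<in> carrier_vec d" for x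
  proof -
    have Ux: "U\<^sup>T *\<^sub>v x \<in> carrier_vec k"
      using U x by auto
    have "U\<^sup>T *\<^sub>v (U *\<^sub>v (U\<^sup>T *\<^sub>v x)) = (U\<^sup>T * U) *\<^sub>v (U\<^sup>T *\<^sub>v x)"
      using U Ux by (intro assoc_mult_mat_vec[symmetric]) auto
    also have "\<dots> = U\<^sup>T *\<^sub>v x"
      using Ux by (simp add: oU)
    finally show ?thesis
      using U x Ux by (simp add: res_def mult_minus_distrib_mat_vec[of _ k d])
  qed
  have "\<exists>r c. r \<in> carrier_vec d \<and> r \<noteq> 0\<^sub>v d \<and> U\<^sup>T *\<^sub>v r = 0\<^sub>v k \<and> res u = c \<cdot>\<^sub>v r"
  proof (cases "res u = 0\<^sub>v d")
    case False
    thus ?thesis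
      using res_carr[OF u] res0[OF u] by (intro exI[of _ "res u"] exI[of _ 1]) auto
  next
    case True
    \<comment> \<open>If every unit vector had zero residual, then \<open>U * U\<^sup>T\<close>
      would be the identity, and comparing traces would give \<open>d = k\<close>.\<close>
    have "\<exists>i<d. res (unit_vec d i) \<noteq> 0\<^sub>v d"
    proof (rule ccontr)
      assume "\<not> ?thesis"
      hence *: "res (unit_vec d i) = 0\<^sub>v d" if "i < d" for i
        using that by auto
      have "U * U\<^sup>T = 1\<^sub>m d"
      proof (rule eq_matI)
        fix i j assume "i < dim_row (1\<^sub>m d :: real mat)" "j < dim_col (1\<^sub>m d :: real mat)"
        hence ij: "i < d" "j < d" by auto
        have "U\<^sup>T *\<^sub>v unit_vec d j = row U j"
          using U ij mult_mat_unit_vec[of "U\<^sup>T" k d j] by simp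
        moreover have "(unit_vec d j - U *\<^sub>v (U\<^sup>T *\<^sub>v unit_vec d j)) $ i = 0"
          using *[OF ij(2)] ij by (simp add: res_def)
        ultimately show "(U * U\<^sup>T) $$ (i, j) = 1\<^sub>m d $$ (i, j)"
          using U ij by simp
      qed (use U in auto)
      hence "real d = trace_mat (U * U\<^sup>T)"
        by (simp add: trace_mat_one)
      also have "\<dots> = trace_mat (U\<^sup>T * U)"
        using U by (intro trace_mat_comm) auto
      also have "\<dots> = real k"
        by (simp add: oU trace_mat_one)
      finally show False
        using k by simp
    qed
    then obtain i where "i < d" "res (unit_vec d i) \<noteq> 0\<^sub>v d"
      by auto
    thus ?thesis
      using res_carr[of "unit_vec d i"] res0[of "unit_vec d i"] True
      by (intro exI[of _ "res (unit_vec d i)"] exI[of _ 0]) auto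
  qed
  then obtain r c where r: "r \<in> carrier_vec d" "r \<noteq> 0\<^sub>v d" and Ur: "U\<^sup>T *\<^sub>v r = 0\<^sub>v k"
    and c: "res u = c \<cdot>\<^sub>v r"
    by auto
  define s where "s = sqrt (r \<bullet> r)"
  have "r \<bullet> r > 0"
    using conjugate_square_greater_0_vec[OF r(1)] r(2) by simp
  hence s: "s > 0" "s * s = r \<bullet> r"
    by (auto simp: s_def)
  define q where "q = (1 / s) \<cdot>\<^sub>v r"
  have q: "q \<in> carrier_vec d"
    using r by (simp add: q_def)
  have qq: "q \<bullet> q = 1"
    using r(1) s(1) by (simp add: q_def flip: s(2))
  have Uq: "col U i \<bullet> q = 0" if "i < k" for i
  proof -
    have "(U\<^sup>T *\<^sub>v r) $ i = 0"
      using that by (simp add: Ur)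
    hence "col U i \<bullet> r = 0"
      using that U by simp
    moreover have "col U i \<in> carrier_vec d"
      using U by auto
    ultimately show ?thesis
      using r by (simp add: q_def)
  qed
  have qU: "q \<bullet> col U i = 0" if "i < k" for i
    using Uq[OF that] comm_scalar_prod[OF q, of "col U i"] U by auto
  define U' where "U' = mat_of_cols d (cols U @ [q])"
  have colU': "col U' j = (if j < k then col U j else q)" if "j < Suc k" for j
    using U q that unfolding U'_def by (subst col_mat_of_cols) (auto simp: nth_append)
  have U': "U' \<in> carrier_mat d (Suc k)"
    using U by (auto simp: U'_def)
  have "orthonormal_cols U"
    using U oU by (simp add: orthonormal_cols_iff)
  hence UU: "col U i \<bullet> col U j = (if i = j then 1 else 0)" if "i < k" "j < k" for i j
    using that U by (simp add: orthonormal_cols_def)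
  have "orthonormal_cols U'"
    unfolding orthonormal_cols_def using U' by (auto simp: colU' UU qq Uq qU less_Suc_eq)
  hence oU': "U'\<^sup>T * U' = 1\<^sub>m (Suc k)"
    using U' orthonormal_cols_iff by blast
  \<comment> \<open>The last coordinate is \<open>c * s\<close> because \<open>res u\<close> is
    \<open>c\<close> times \<open>r\<close>, and \<open>r\<close> is \<open>s\<close> times the unit
    vector \<open>q\<close>.\<close>
  define w where "w = vec (Suc k) (\<lambda>j. if j < k then (U\<^sup>T *\<^sub>v u) $ j else c * s)"
  have "u = U' *\<^sub>v w"
  proof (rule eq_vecI)
    fix i assume "i < dim_vec (U' *\<^sub>v w)"
    hence i: "i < d"
      using U' by simp
    have entry: "U' $$ (i, j) = (if j < k then U $$ (i, j) else q $ i)" if "j < Suc k" for j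
    proof -
      have "U' $$ (i, j) = col U' j $ i"
        using i that U' by simp
      also have "\<dots> = (if j < k then U $$ (i, j) else q $ i)"
        using i U by (simp add: colU'[OF that])
      finally show ?thesis .
    qed
    have "(U' *\<^sub>v w) $ i = (\<Sum>j<Suc k. U' $$ (i, j) * w $ j)"
      using i U' by (simp add: scalar_prod_def w_def lessThan_atLeast0)
    also have "\<dots> = (\<Sum>j<k. U $$ (i, j) * (U\<^sup>T *\<^sub>v u) $ j) + q $ i * (c * s)"
      by (simp add: entry w_def)
    also have "(\<Sum>j<k. U $$ (i, j) * (U\<^sup>T *\<^sub>v u) $ j) = (U *\<^sub>v (U\<^sup>T *\<^sub>v u)) $ i"
      using i U by (simp add: scalar_prod_def lessThan_atLeast0)
    also have "q $ i * (c * s) = res u $ i"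
      using i r s by (simp add: c q_def)
    finally show "u $ i = (U' *\<^sub>v w) $ i"
      using i U u by (simp add: res_def)
  qed (use U' u in auto)
  moreover have "w \<in> carrier_vec (Suc k)"
    by (simp add: w_def)
  ultimately show ?thesis
    using U' oU' colU' by (intro exI[of _ U'] exI[of _ w]) auto
qed

text \<open>Downward induction on \<open>m\<close>, starting at \<open>m = d\<close>. Extending by
  the zero vector always takes the degenerate branch of the Gram-Schmidt step, so a fresh orthogonal
  column is appended.\<close>

lemma orthonormal_completion:
  fixes U :: "real mat"
  assumes "U \<in> carrier_mat d m" "U\<^sup>T * U = 1\<^sub>m m" "m \<le> d"
  shows "\<exists>P. P \<in> carrier_mat d d \<and> P\<^sup>T * P = 1\<^sub>m d \<and> (\<forall>j<m. col P j = col U j)"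
  using assms(3,1,2)
proof (induction m arbitrary: U rule: inc_induct)
  case base
  thus ?case by auto
next
  case (step m)
  obtain U' w where "U' \<in> carrier_mat d (Suc m)" "U'\<^sup>T * U' = 1\<^sub>m (Suc m)"
      "\<forall>j<m. col U' j = col U j"
    using orthonormal_extend[OF step.prems step.hyps(2), of "0\<^sub>v d"] by auto
  with step.IH[of U'] show ?case
    by auto
qed

text \<open>A QR-type decomposition that also covers rank-deficient \<open>U\<close>; columns
  dependent on earlier ones still contribute a new orthonormal direction. It serves to normalise the
  left factor of a product \<open>U * V\<^sup>T\<close>.\<close>

lemma orthonormal_factorization:
  fixes U :: "real mat"
  assumes "U \<in> carrier_mat d k" "k \<le> d"
  shows "\<exists>P B. P \<in> carrier_mat d k \<and> P\<^sup>T * P = 1\<^sub>m k \<and> B \<in> carrier_mat k k \<and> U = P * B"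
proof -
  have "\<exists>P. P \<in> carrier_mat d m \<and> P\<^sup>T * P = 1\<^sub>m m \<and>
      (\<forall>j<m. \<exists>w\<in>carrier_vec m. col U j = P *\<^sub>v w)" if "m \<le> k" for m
    using that
  proof (induction m)
    case 0
    show ?case
      by (intro exI[of _ "0\<^sub>m d 0"]) auto
  next
    case (Suc m)
    then obtain P where P: "P \<in> carrier_mat d m" "P\<^sup>T * P = 1\<^sub>m m"
      and PU: "\<forall>j<m. \<exists>w\<in>carrier_vec m. col U j = P *\<^sub>v w"
      by auto
    have "m < d" "col U m \<in> carrier_vec d"
      using Suc.prems assms by auto
    from orthonormal_extend[OF P this] obtain P' w
      where P': "P' \<in> carrier_mat d (Suc m)" "P'\<^sup>T * P' = 1\<^sub>m (Suc m)"
        and cols: "\<forall>j<m. col P' j = col P j"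
        and w: "w \<in> carrier_vec (Suc m)" "col U m = P' *\<^sub>v w"
      by auto
    have "\<exists>w\<in>carrier_vec (Suc m). col U j = P' *\<^sub>v w" if j: "j < m" for j
    proof -
      obtain v where v: "v \<in> carrier_vec m" "col U j = P *\<^sub>v v"
        using PU j by auto
      define v' where "v' = vec (Suc m) (\<lambda>i. if i < m then v $ i else 0)"
      have entry: "P' $$ (i, l) = P $$ (i, l)" if "i < d" "l < m" for i l
        using cols P P' that by (metis carrier_matD index_col less_SucI)
      have "P *\<^sub>v v = P' *\<^sub>v v'"
      proof (rule eq_vecI)
        fix i assume "i < dim_vec (P' *\<^sub>v v')"
        thus "(P *\<^sub>v v) $ i = (P' *\<^sub>v v') $ i"
          using P P' v by (simp add: scalar_prod_def v'_def entry)
      qed (use P P' in auto)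
      thus ?thesis
        using v by (intro bexI[of _ v']) (auto simp: v'_def)
    qed
    hence "\<forall>j<Suc m. \<exists>w\<in>carrier_vec (Suc m). col U j = P' *\<^sub>v w"
      using w by (auto simp: less_Suc_eq)
    with P' show ?case
      by blast
  qed
  from this[of k] obtain P where P: "P \<in> carrier_mat d k" "P\<^sup>T * P = 1\<^sub>m k"
    and "\<forall>j<k. \<exists>w\<in>carrier_vec k. col U j = P *\<^sub>v w"
    by auto
  then obtain w where w: "\<And>j. j < k \<Longrightarrow> w j \<in> carrier_vec k \<and> col U j = P *\<^sub>v w j"
    by metis
  define B where "B = mat_of_cols k (map w [0..<k])"
  have B: "B \<in> carrier_mat k k"
    by (simp add: B_def mat_of_cols_def)
  have colB: "col B j = w j" if "j < k" for j
    using that w unfolding B_def by (subst col_mat_of_cols) auto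
  have "U = P * B"
  proof (rule eq_matI)
    fix i j assume "i < dim_row (P * B)" "j < dim_col (P * B)"
    hence ij: "i < d" "j < k"
      using P B by auto
    have "U $$ (i, j) = col U j $ i"
      using ij assms by simp
    also have "\<dots> = (P *\<^sub>v w j) $ i"
      using w ij by simp
    also have "\<dots> = (P * B) $$ (i, j)"
      using ij P B by (simp add: colB)
    finally show "U $$ (i, j) = (P * B) $$ (i, j)" .
  qed (use P B assms in auto)
  with P B show ?thesis
    by blast
qed

section \<open>Spectral theorem and Ky Fan's principle\<close>

text \<open>The polynomial splits over the complex numbers. Moving the symmetric matrix across the
  Hermitian product of an eigenvector with itself shows that each root equals its conjugate, so the
  factorization is the image of a real one.\<close>

lemma symmetric_char_poly_splits:
  fixes S :: "real mat"
  assumes S: "S \<in> carrier_mat d d" and sym: "S\<^sup>T = S"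
  shows "\<exists>es. char_poly S = (\<Prod>e\<leftarrow>es. [:- e, 1:])"
proof -
  interpret map_poly_inj_idom_hom complex_of_real ..
  define Sc where "Sc = map_mat complex_of_real S"
  have Sc: "Sc \<in> carrier_mat d d"
    using S by (simp add: Sc_def)
  have ScT: "Sc\<^sup>T = Sc"
    using sym by (metis Sc_def map_mat_transpose)
  obtain as where as: "char_poly Sc = (\<Prod>a\<leftarrow>as. [:- a, 1:])"
    using char_poly_factorized[OF Sc] by auto
  have real: "complex_of_real (Re a) = a" if a: "a \<in> set as" for a
  proof -
    have "poly (char_poly Sc) a = 0"
      using a unfolding as by (auto simp: poly_prod_list prod_list_zero_iff)
    then obtain v where "eigenvector Sc v a"
      using eigenvalue_root_char_poly[OF Sc] by (auto simp: eigenvalue_def)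
    hence v: "v \<in> carrier_vec d" "v \<noteq> 0\<^sub>v d" and Sv: "Sc *\<^sub>v v = a \<cdot>\<^sub>v v"
      using Sc by (auto simp: eigenvector_def)
    \<comment> \<open>The entries of \<open>Sc\<close> are real, so conjugation passes through the
      product.\<close>
    have "Sc *\<^sub>v conjugate v = conjugate (Sc *\<^sub>v v)"
      using S Sc v by (intro eq_vecI) (auto simp: scalar_prod_def Sc_def)
    hence Scv: "Sc *\<^sub>v conjugate v = cnj a \<cdot>\<^sub>v conjugate v"
      by (simp add: Sv conjugate_smult_vec)
    have "(Sc\<^sup>T *\<^sub>v v) \<bullet> conjugate v = v \<bullet> (Sc *\<^sub>v conjugate v)"
      using Sc v by (intro transpose_vec_mult_scalar[of _ d d]) auto
    hence "a * (v \<bullet>c v) = cnj a * (v \<bullet>c v)"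
      using v by (simp add: ScT Sv Scv)
    moreover have "v \<bullet>c v \<noteq> 0"
      using conjugate_square_eq_0_vec[OF v(1)] v(2) by simp
    ultimately have "a = cnj a"
      by simp
    thus ?thesis
      by (metis Reals_cnj_iff of_real_Re)
  qed
  define es where "es = map Re as"
  have "as = map complex_of_real es"
    using real by (auto simp: es_def o_def intro!: map_idI[symmetric])
  hence "char_poly Sc = (\<Prod>e\<leftarrow>es. [:- complex_of_real e, 1:])"
    by (simp add: as o_def)
  also have "\<dots> = map_poly complex_of_real (\<Prod>e\<leftarrow>es. [:- e, 1:])"
    by (induction es) (simp_all add: hom_mult of_real_hom.map_poly_pCons_hom del: mult_pCons_left)
  finally have "map_poly complex_of_real (char_poly S) = map_poly complex_of_real (\<Prod>e\<leftarrow>es. [:- e, 1:])"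
    unfolding Sc_def of_real_hom.char_poly_hom[OF S] .
  thus ?thesis
    using injectivity by blast
qed

lemma length_char_poly_roots:
  fixes S :: "'a :: idom mat"
  assumes "S \<in> carrier_mat d d" "char_poly S = (\<Prod>e\<leftarrow>es. [:- e, 1:])"
  shows "length es = d"
  using degree_monic_char_poly[OF assms(1)] degree_linear_factors[of uminus es] assms(2) by simp

text \<open>Deflation: split off a unit eigenvector for the head of \<open>es\<close> and recurse on
  its orthogonal complement. The diagonal follows the prescribed order of \<open>es\<close>, so a
  list with the largest eigenvalues in front can be chosen beforehand.\<close>

theorem symmetric_diagonalization:
  fixes S :: "real mat"
  assumes "S \<in> carrier_mat d d" "S\<^sup>T = S" "char_poly S = (\<Prod>e\<leftarrow>es. [:- e, 1:])"
  shows "\<exists>P. P \<in> carrier_mat d d \<and> P\<^sup>T * P = 1\<^sub>m d \<and> P\<^sup>T * S * P = mat_diag d (\<lambda>i. es ! i)"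
  using assms
proof (induction es arbitrary: d S)
  case Nil
  hence "d = 0"
    using length_char_poly_roots[of S d "[]"] by simp
  thus ?case
    using Nil.prems(1) by (intro exI[of _ "1\<^sub>m d"]) (auto simp: mat_diag_def intro!: eq_matI)
next
  case (Cons e es)
  obtain n where d: "d = Suc n"
    using length_char_poly_roots[OF Cons.prems(1,3)] by auto
  note S = Cons.prems(1)
  have "poly (char_poly S) e = 0"
    by (simp add: Cons.prems(3))
  then obtain v where "eigenvector S v e"
    using eigenvalue_root_char_poly[OF S] by (auto simp: eigenvalue_def)
  hence v: "v \<in> carrier_vec d" "v \<noteq> 0\<^sub>v d" and Sv: "S *\<^sub>v v = e \<cdot>\<^sub>v v"
    using S by (auto simp: eigenvector_def)
  define s where "s = sqrt (v \<bullet> v)"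
  have "v \<bullet> v > 0"
    using conjugate_square_greater_0_vec[OF v(1)] v(2) by simp
  hence s: "s > 0" "s * s = v \<bullet> v"
    by (auto simp: s_def)
  define q where "q = (1 / s) \<cdot>\<^sub>v v"
  have q: "q \<in> carrier_vec d"
    using v by (simp add: q_def)
  have qq: "q \<bullet> q = 1"
    using v(1) s(1) by (simp add: q_def flip: s(2))
  have Sq: "S *\<^sub>v q = e \<cdot>\<^sub>v q"
    using S v by (simp add: q_def mult_mat_vec[of _ d d] Sv smult_smult_assoc mult.commute)
  define U where "U = mat_of_cols d [q]"
  have U: "U \<in> carrier_mat d 1" and colU: "col U 0 = q"
    using q by (auto simp: U_def col_mat_of_cols)
  have "orthonormal_cols U"
    using U by (simp add: orthonormal_cols_def colU qq)
  hence "U\<^sup>T * U = 1\<^sub>m 1"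
    using orthonormal_cols_iff[OF U] by simp
  from orthonormal_completion[OF U this] obtain R
    where R: "R \<in> carrier_mat d d" and oR: "R\<^sup>T * R = 1\<^sub>m d" and colR: "col R 0 = q"
    using d colU by auto
  define A where "A = R\<^sup>T * S * R"
  have A: "A \<in> carrier_mat d d"
    using R S by (simp add: A_def)
  have A_sym: "A\<^sup>T = A"
    using R S Cons.prems(2)
    by (simp add: A_def transpose_mult[of _ d d _ d] assoc_mult_mat[of _ d d _ d _ d])
  \<comment> \<open>In the basis \<open>R\<close> the eigenvector is the first basis vector, so the
    first column of \<open>A\<close> is zero below the diagonal. Symmetry clears the first row as
    well and \<open>A\<close> becomes block diagonal.\<close>
  have A0: "A $$ (i, 0) = (if i = 0 then e else 0)" if i: "i < d" for i
  proof -
    have "A $$ (i, 0) = row R\<^sup>T i \<bullet> col (S * R) 0"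
      using R S i d by (simp add: A_def assoc_mult_mat[of _ d d _ d _ d])
    also have "col (S * R) 0 = S *\<^sub>v q"
      using R S d colR by (metis col_mult2 zero_less_Suc)
    also have "row R\<^sup>T i \<bullet> (S *\<^sub>v q) = e * (col R i \<bullet> col R 0)"
      using R i q by (simp add: Sq colR)
    also have "col R i \<bullet> col R 0 = (R\<^sup>T * R) $$ (i, 0)"
      using R i d by simp
    finally show ?thesis
      using i d by (simp add: oR)
  qed
  define E where "E = mat 1 1 (\<lambda>_. e)"
  define S' where "S' = mat n n (\<lambda>(i, j). A $$ (Suc i, Suc j))"
  have E: "E \<in> carrier_mat 1 1" and S': "S' \<in> carrier_mat n n"
    by (auto simp: E_def S'_def)
  have A_block: "A = four_block_mat E (0\<^sub>m 1 n) (0\<^sub>m n 1) S'"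
  proof (rule eq_matI)
    fix i j assume "i < dim_row (four_block_mat E (0\<^sub>m 1 n) (0\<^sub>m n 1) S')"
      "j < dim_col (four_block_mat E (0\<^sub>m 1 n) (0\<^sub>m n 1) S')"
    hence ij: "i < d" "j < d"
      using d E S' by auto
    have "A $$ (0, j) = A $$ (j, 0)"
      using A_sym A ij d by (metis carrier_matD index_transpose_mat(1) zero_less_Suc)
    thus "A $$ (i, j) = four_block_mat E (0\<^sub>m 1 n) (0\<^sub>m n 1) S' $$ (i, j)"
      using ij d A0[of i] A0[of j] by (cases i; cases j) (auto simp: E_def S'_def)
  qed (use A E S' d in auto)
  have "A $$ (i, j) = A $$ (j, i)" if "i < d" "j < d" for i j
    using A_sym A that by (metis carrier_matD index_transpose_mat(1))
  hence S'_sym: "S'\<^sup>T = S'"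
    using d by (intro eq_matI) (auto simp: S'_def)
  have RR: "R * R\<^sup>T = 1\<^sub>m d"
    using mat_mult_left_right_inverse[of "R\<^sup>T" d R] R oR by auto
  have "similar_mat_wit A S R\<^sup>T R"
    using A S R oR RR by (intro similar_mat_witI[of _ _ d]) (auto simp: A_def)
  hence "char_poly A = char_poly S"
    by (intro char_poly_similar) (auto simp: similar_mat_def)
  moreover have "char_poly A = char_poly E * char_poly S'"
    unfolding A_block by (rule char_poly_four_block_zeros_col[OF E _ S']) auto
  moreover have "char_poly E = [:- e, 1:]"
    by (simp add: E_def char_poly_defs det_def sign_def)
  \<comment> \<open>Cancelling one linear factor leaves exactly the polynomial that the induction
    hypothesis asks for.\<close>
  ultimately have "[:- e, 1:] * char_poly S' = [:- e, 1:] * (\<Prod>e\<leftarrow>es. [:- e, 1:])"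
    using Cons.prems(3) by simp
  hence "char_poly S' = (\<Prod>e\<leftarrow>es. [:- e, 1:])"
    by (metis mult_cancel_left pCons_eq_0_iff zero_neq_one)
  from Cons.IH[OF S' S'_sym this] obtain P'
    where P': "P' \<in> carrier_mat n n" and oP': "P'\<^sup>T * P' = 1\<^sub>m n"
      and diag: "P'\<^sup>T * S' * P' = mat_diag n (\<lambda>i. es ! i)"
    by auto
  \<comment> \<open>\<open>B\<close> lets \<open>P'\<close> act on the complement and fixes the
    eigenvector; \<open>R * B\<close> is the required basis.\<close>
  define B where "B = four_block_mat (1\<^sub>m 1) (0\<^sub>m 1 n) (0\<^sub>m n 1) P'"
  have B: "B \<in> carrier_mat d d"
    using P' d by (auto simp: B_def)
  have BT: "B\<^sup>T = four_block_mat (1\<^sub>m 1) (0\<^sub>m 1 n) (0\<^sub>m n 1) P'\<^sup>T"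
    unfolding B_def using P'
    by (subst transpose_four_block_mat[of _ 1 1 _ n _ n]) auto
  have "B\<^sup>T * B = four_block_mat (1\<^sub>m 1) (0\<^sub>m 1 n) (0\<^sub>m n 1) (1\<^sub>m n)"
    unfolding BT unfolding B_def using P'
    by (subst mult_four_block_mat[of _ 1 1 _ n _ n _ _ 1 _ n]) (auto simp: oP')
  also have "\<dots> = 1\<^sub>m d"
    unfolding d by (rule eq_matI) auto
  finally have oB: "B\<^sup>T * B = 1\<^sub>m d" .
  have "B\<^sup>T * A = four_block_mat E (0\<^sub>m 1 n) (0\<^sub>m n 1) (P'\<^sup>T * S')"
    unfolding BT A_block using P' E S'
    by (subst mult_four_block_mat[of _ 1 1 _ n _ n _ _ 1 _ n]) auto
  hence "B\<^sup>T * A * B = four_block_mat E (0\<^sub>m 1 n) (0\<^sub>m n 1) (P'\<^sup>T * S' * P')"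
    unfolding B_def using P' E S'
    by (simp, subst mult_four_block_mat[of _ 1 1 _ n _ n _ _ 1 _ n]) auto
  also have "\<dots> = mat_diag d (\<lambda>i. (e # es) ! i)"
    unfolding diag d by (rule eq_matI) (auto simp: E_def mat_diag_def nth_Cons')
  finally have BAB: "B\<^sup>T * A * B = mat_diag d (\<lambda>i. (e # es) ! i)" .
  have "(R * B)\<^sup>T * (R * B) = B\<^sup>T * (R\<^sup>T * R * B)"
    using R B by (simp add: transpose_mult[of _ d d _ d] assoc_mult_mat[of _ d d _ d _ d])
  hence "(R * B)\<^sup>T * (R * B) = 1\<^sub>m d"
    using B by (simp add: oR oB)
  moreover have "(R * B)\<^sup>T * S * (R * B) = B\<^sup>T * A * B"
    using R B S by (simp add: A_def transpose_mult[of _ d d _ d] assoc_mult_mat[of _ d d _ d _ d])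
  moreover have "R * B \<in> carrier_mat d d"
    using R B by simp
  ultimately show ?case
    using BAB by (intro exI[of _ "R * B"]) simp
qed

lemma diagonalization_eigenvector:
  fixes S :: "real mat"
  assumes S: "S \<in> carrier_mat d d" and P: "P \<in> carrier_mat d d" and oP: "P\<^sup>T * P = 1\<^sub>m d"
    and diag: "P\<^sup>T * S * P = mat_diag d f" and i: "i < d"
  shows "eigenvector S (col P i) (f i)"
proof -
  have PP: "P * P\<^sup>T = 1\<^sub>m d"
    using mat_mult_left_right_inverse[of "P\<^sup>T" d P] P oP by auto
  have "P * (P\<^sup>T * S * P) = P * P\<^sup>T * (S * P)"
    using P S by (simp add: assoc_mult_mat[of _ d d _ d _ d])
  hence SP: "S * P = P * mat_diag d f"
    using P S by (simp add: PP diag)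
  have "S *\<^sub>v col P i = col (S * P) i"
    using P S i by (metis col_mult2)
  also have "\<dots> = f i \<cdot>\<^sub>v col P i"
    using P i by (intro eq_vecI) (auto simp: SP mat_diag_mult_right mult.commute)
  finally have Sv: "S *\<^sub>v col P i = f i \<cdot>\<^sub>v col P i" .
  have "col P i \<bullet> col P i = (P\<^sup>T * P) $$ (i, i)"
    using P i by simp
  hence "col P i \<noteq> 0\<^sub>v d"
    using i by (auto simp: oP)
  thus ?thesis
    using Sv S P by (auto simp: eigenvector_def)
qed

text \<open>\<open>U * U\<^sup>T\<close> is an orthogonal projection. Its diagonal entry equals the
  sum of the squares of its row, hence is at least its own square, hence at most one.\<close>

lemma row_sum_squares_le_1:
  fixes U :: "real mat"
  assumes U: "U \<in> carrier_mat d k" and oU: "U\<^sup>T * U = 1\<^sub>m k" and i: "i < d"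
  shows "(\<Sum>j<k. (U $$ (i, j))\<^sup>2) \<le> 1"
proof -
  define w where "w = (\<Sum>j<k. (U $$ (i, j))\<^sup>2)"
  define H where "H = U * U\<^sup>T"
  have H: "H \<in> carrier_mat d d" and HT: "H\<^sup>T = H"
    using U by (auto simp: H_def transpose_mult[of _ d k _ d])
  have "H * H = U * (U\<^sup>T * U) * U\<^sup>T"
    using U by (simp add: H_def assoc_mult_mat[of _ d k _ d _ d] assoc_mult_mat[of _ d k _ k _ d]
        assoc_mult_mat[of _ k d _ k _ d])
  hence "H * H = H"
    using U by (simp add: oU H_def)
  hence "H $$ (i, i) = (H * H\<^sup>T) $$ (i, i)"
    by (simp add: HT)
  also have "\<dots> = (\<Sum>j<d. (H $$ (i, j))\<^sup>2)"
    using H i by (simp add: scalar_prod_def lessThan_atLeast0 power2_eq_square)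
  also have "\<dots> \<ge> (H $$ (i, i))\<^sup>2"
    using i by (intro member_le_sum[of i]) auto
  finally have "H $$ (i, i) * H $$ (i, i) \<le> H $$ (i, i)"
    by (simp add: power2_eq_square)
  hence "H $$ (i, i) \<le> 1"
    using mult_strict_right_mono[of 1 "H $$ (i, i)" "H $$ (i, i)"] by fastforce
  moreover have "H $$ (i, i) = w"
    using U i by (simp add: H_def w_def scalar_prod_def lessThan_atLeast0 power2_eq_square)
  ultimately show ?thesis
    by (simp add: w_def)
qed

text \<open>The threshold \<open>t\<close>, the least of the first \<open>k\<close> values,
  separates them from the others. Replacing every value by \<open>t\<close> can only increase the
  difference of the two sums, and turns it into \<open>t * k - t * k\<close>.\<close>

lemma weighted_sum_le_top_sum:
  fixes f w :: "nat \<Rightarrow> real"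
  assumes "k \<le> d" and top: "\<And>i j. i < k \<Longrightarrow> k \<le> j \<Longrightarrow> j < d \<Longrightarrow> f j \<le> f i"
    and w: "\<And>i. i < d \<Longrightarrow> 0 \<le> w i \<and> w i \<le> 1" and sum_w: "(\<Sum>i<d. w i) = real k"
  shows "(\<Sum>i<d. f i * w i) \<le> (\<Sum>i<k. f i)"
\<comment> \<open>The threshold is a minimum over the first \<open>k\<close> values, so the empty
  case is treated apart.\<close>
proof (cases "k = 0")
  case True
  hence "w i = 0" if "i < d" for i
    using sum_w w that True sum_nonneg_eq_0_iff[of "{..<d}" w] by simp
  thus ?thesis
    by (simp add: True)
next
  case False
  define t where "t = Min (f ` {..<k})"
  have t_le: "t \<le> f i" if "i < k" for i
    using that by (auto simp: t_def)
  have "t \<in> f ` {..<k}"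
    unfolding t_def using False by (intro Min_in) auto
  hence le_t: "f j \<le> t" if "k \<le> j" "j < d" for j
    using top that by auto
  have split: "sum h {..<d} = sum h {..<k} + sum h {k..<d}" for h :: "nat \<Rightarrow> real"
    using \<open>k \<le> d\<close> by (simp add: lessThan_atLeast0 sum.atLeastLessThan_concat)
  have "(\<Sum>i<k. f i * w i - f i) \<le> (\<Sum>i<k. t * w i - t)"
  proof (rule sum_mono)
    fix i assume "i \<in> {..<k}"
    hence "0 \<le> (f i - t) * (1 - w i)"
      using t_le[of i] w[of i] \<open>k \<le> d\<close> by auto
    thus "f i * w i - f i \<le> t * w i - t"
      by (simp add: algebra_simps)
  qed
  moreover have "(\<Sum>i=k..<d. f i * w i) \<le> (\<Sum>i=k..<d. t * w i)"
    using le_t w by (intro sum_mono mult_right_mono) auto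
  moreover have "(\<Sum>i<k. t * w i) + (\<Sum>i=k..<d. t * w i) = t * real k"
    using sum_w by (simp add: split sum_distrib_left[symmetric] flip: distrib_left)
  ultimately show ?thesis
    by (simp add: split sum_subtractf mult.commute)
qed

text \<open>In an eigenbasis the trace is a sum of eigenvalues weighted by the squared row norms of
  \<open>Z\<close>. These weights lie between zero and one and add up to \<open>k\<close>.\<close>

theorem ky_fan:
  fixes S :: "real mat"
  assumes S: "S \<in> carrier_mat d d" and sym: "S\<^sup>T = S" and cp: "char_poly S = (\<Prod>e\<leftarrow>es. [:- e, 1:])"
    and k: "k \<le> d" and top: "\<And>i j. i < k \<Longrightarrow> k \<le> j \<Longrightarrow> j < d \<Longrightarrow> es ! j \<le> es ! i"
    and U: "U \<in> carrier_mat d k" and oU: "U\<^sup>T * U = 1\<^sub>m k"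
  shows "trace_mat (U\<^sup>T * S * U) \<le> (\<Sum>i<k. es ! i)"
proof -
  obtain P where P: "P \<in> carrier_mat d d" and oP: "P\<^sup>T * P = 1\<^sub>m d"
    and diag: "P\<^sup>T * S * P = mat_diag d (\<lambda>i. es ! i)"
    using symmetric_diagonalization[OF S sym cp] by auto
  have PP: "P * P\<^sup>T = 1\<^sub>m d"
    using mat_mult_left_right_inverse[of "P\<^sup>T" d P] P oP by auto
  define D where "D = mat_diag d (\<lambda>i. es ! i)"
  define Z where "Z = P\<^sup>T * U"
  have D: "D \<in> carrier_mat d d" and Z: "Z \<in> carrier_mat d k"
    using P U by (auto simp: D_def Z_def)
  have PZ: "P * Z = U"
  proof -
    have "P * Z = P * P\<^sup>T * U"
      using P U by (simp add: Z_def assoc_mult_mat[of _ d d _ d _ k])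
    thus ?thesis
      using U by (simp add: PP)
  qed
  have "Z\<^sup>T * Z = U\<^sup>T * (P * Z)"
    unfolding Z_def using P U
    by (simp add: transpose_mult[of _ d d _ k] assoc_mult_mat[of _ k d _ d _ k])
  hence oZ: "Z\<^sup>T * Z = 1\<^sub>m k"
    by (simp add: PZ oU)
  have "U\<^sup>T * S * U = Z\<^sup>T * (P\<^sup>T * S * P) * Z"
    unfolding PZ[symmetric] using P Z S
    by (simp add: transpose_mult[of _ d d _ k] assoc_mult_mat[of _ k d _ d _ k]
        assoc_mult_mat[of _ k d _ d _ d] assoc_mult_mat[of _ d d _ d _ d] assoc_mult_mat[of _ d d _ d _ k])
  hence "trace_mat (U\<^sup>T * S * U) = trace_mat (Z\<^sup>T * (D * Z))"
    using D Z by (simp add: diag D_def[symmetric] assoc_mult_mat[of _ k d _ d _ k])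
  also have "\<dots> = trace_mat (D * Z * Z\<^sup>T)"
    using D Z by (intro trace_mat_comm[of _ k d]) auto
  also have "\<dots> = (\<Sum>i<d. es ! i * (\<Sum>j<k. (Z $$ (i, j))\<^sup>2))"
    using Z D by (subst trace_mat_mult[of _ d k])
      (auto simp: D_def mat_diag_mult_left sum_distrib_left power2_eq_square mult.assoc intro!: sum.cong)
  also have "\<dots> \<le> (\<Sum>i<k. es ! i)"
  proof (rule weighted_sum_le_top_sum[OF k])
    have "(\<Sum>i<d. \<Sum>j<k. (Z $$ (i, j))\<^sup>2) = trace_mat (Z * Z\<^sup>T)"
      using Z by (subst trace_mat_mult[of _ d k]) (auto simp: power2_eq_square intro!: sum.cong)
    also have "\<dots> = trace_mat (Z\<^sup>T * Z)"
      using Z by (intro trace_mat_comm[of _ d k]) auto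
    finally show "(\<Sum>i<d. \<Sum>j<k. (Z $$ (i, j))\<^sup>2) = real k"
      by (simp add: oZ trace_mat_one)
  qed (use top row_sum_squares_le_1[OF Z oZ] in \<open>auto intro: sum_nonneg\<close>)
  finally show ?thesis .
qed

lemma top_eigenvectors_exist:
  assumes S: "S \<in> carrier_mat d d" and sym: "S\<^sup>T = S" and k: "k \<le> d"
  shows "\<exists>U. top_eigenvectors k S U"
proof -
  obtain es0 where es0: "char_poly S = (\<Prod>e\<leftarrow>es0. [:- e, 1:])"
    using symmetric_char_poly_splits[OF S sym] by auto
  \<comment> \<open>Decreasing order puts the largest eigenvalues first; the product of linear
    factors is unchanged by the permutation.\<close>
  define es where "es = rev (sort es0)"
  have "mset (map (\<lambda>e. [:- e, 1:]) es) = mset (map (\<lambda>e. [:- e, 1:]) es0)"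
    by (simp add: es_def)
  hence es: "char_poly S = (\<Prod>e\<leftarrow>es. [:- e, 1:])"
    unfolding es0 by (metis prod_mset_prod_list)
  have len: "length es = d"
    by (rule length_char_poly_roots[OF S es])
  obtain P where P: "P \<in> carrier_mat d d" and oP: "P\<^sup>T * P = 1\<^sub>m d"
    and diag: "P\<^sup>T * S * P = mat_diag d (\<lambda>i. es ! i)"
    using symmetric_diagonalization[OF S sym es] by auto
  define U where "U = mat d k (\<lambda>(i, j). P $$ (i, j))"
  have U: "U \<in> carrier_mat d k"
    by (simp add: U_def)
  have colU: "col U j = col P j" if "j < k" for j
    using that k P by (intro eq_vecI) (auto simp: U_def)
  have "orthonormal_cols P"
    using orthonormal_cols_iff[OF P] oP by simp
  hence "orthonormal_cols U"
    using U P k by (auto simp: orthonormal_cols_def colU)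
  moreover have "es ! j \<le> es ! i" if "i < k" "k \<le> j" "j < length es" for i j
  proof -
    have "length es0 = d"
      using len by (simp add: es_def)
    thus ?thesis
      using that len k unfolding es_def by (auto simp: rev_nth intro!: sorted_nth_mono)
  qed
  moreover have "eigenvector S (col U j) (es ! j)" if "j < k" for j
    using that k diagonalization_eigenvector[OF S P oP diag, of j] by (simp add: colU)
  ultimately show ?thesis
    unfolding top_eigenvectors_def using U S es k len by auto
qed

text \<open>The Ky Fan bound is attained, since each unit eigenvector contributes its own eigenvalue
  to the trace. The list \<open>es\<close> comes with \<open>U\<close> itself, so ties between
  eigenvalues do no harm.\<close>

lemma top_eigenvectors_maximal:
  assumes S: "S \<in> carrier_mat d d" and sym: "S\<^sup>T = S" and k: "k \<le> d"
    and top: "top_eigenvectors k S U"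
    and U': "U' \<in> carrier_mat d k" and oU': "orthonormal_cols U'"
  shows "trace_mat (U'\<^sup>T * S * U') \<le> trace_mat (U\<^sup>T * S * U)"
proof -
  obtain es where es: "char_poly S = (\<Prod>e\<leftarrow>es. [:- e, 1:])"
    and le: "\<forall>i<k. \<forall>j. k \<le> j \<and> j < length es \<longrightarrow> es ! j \<le> es ! i"
    and ev: "\<forall>j<k. eigenvector S (col U j) (es ! j)"
    using top unfolding top_eigenvectors_def by auto
  have U: "U \<in> carrier_mat d k" and oU: "orthonormal_cols U"
    using top S unfolding top_eigenvectors_def by auto
  have "trace_mat (U'\<^sup>T * S * U') \<le> (\<Sum>i<k. es ! i)"
    using le oU' length_char_poly_roots[OF S es]
    by (intro ky_fan[OF S sym es k _ U']) (auto simp: orthonormal_cols_iff[OF U'])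
  also have "(\<Sum>i<k. es ! i) = (\<Sum>i<k. (U\<^sup>T * S * U) $$ (i, i))"
  proof (rule sum.cong)
    fix i assume "i \<in> {..<k}"
    hence i: "i < k"
      by simp
    have "(U\<^sup>T * S * U) $$ (i, i) = col U i \<bullet> col (S * U) i"
      using U S i by (simp add: assoc_mult_mat[of _ k d _ d _ k])
    also have "col (S * U) i = S *\<^sub>v col U i"
      using U S i by (metis col_mult2)
    also have "\<dots> = es ! i \<cdot>\<^sub>v col U i"
      using ev i by (auto simp: eigenvector_def)
    also have "col U i \<bullet> \<dots> = es ! i * (col U i \<bullet> col U i)"
      by (simp add: scalar_prod_smult_distrib[of _ d] carrier_vecI)
    also have "col U i \<bullet> col U i = 1"
      using oU U i by (simp add: orthonormal_cols_def)
    finally show "es ! i = (U\<^sup>T * S * U) $$ (i, i)"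
      by simp
  qed simp
  finally show ?thesis
    using U by (simp add: trace_mat_def)
qed

section \<open>Gram matrix of a full-rank matrix\<close>

text \<open>A maximal independent set of columns has \<open>d\<close> elements and is a basis. As
  \<open>v\<close> is orthogonal to each of them, expanding one copy of \<open>v\<close> in this
  basis gives \<open>v \<bullet> v = 0\<close>.\<close>

lemma full_row_rank_left_kernel:
  fixes X :: "real mat"
  assumes X: "X \<in> carrier_mat d n" and rank: "vec_space.rank d X = d"
    and v: "v \<in> carrier_vec d" and Xv: "X\<^sup>T *\<^sub>v v = 0\<^sub>v n"
  shows "v = 0\<^sub>v d"
proof -
  interpret vec_space "TYPE(real)" d .
  have cX: "set (cols X) \<subseteq> carrier_vec d"
    using X cols_dim by blast
  obtain B where B: "finite B" "maximal B (\<lambda>T. T \<subseteq> set (cols X) \<and> lin_indpt T)"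
    using maximal_exists_superset[of "set (cols X)" "\<lambda>T. T \<subseteq> set (cols X) \<and> lin_indpt T" "{}"]
      finite_lin_indpt2[of "{}"] by auto
  hence BX: "B \<subseteq> set (cols X)" and indep: "lin_indpt B"
    by (auto simp: maximal_def)
  have "card B = d"
    using rank_card_indpt[OF X B(2)] rank by simp
  hence "basis B"
    using BX cX B(1) indep by (intro dim_li_is_basis) (auto simp: dim_is_n)
  hence "v \<in> span B"
    using v by (simp add: basis_def)
  then obtain a where a: "v = lincomb a B"
    using finite_in_span[OF B(1)] BX cX by blast
  have Bc: "B \<subseteq> carrier_vec d"
    using BX cX by auto
  have orth: "x \<bullet> v = 0" if x: "x \<in> B" for x
  proof -
    obtain j where j: "j < n" "x = col X j"
      using x BX X by (metis carrier_matD(2) cols_length cols_nth in_set_conv_nth subsetD)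
    have "x \<bullet> v = (X\<^sup>T *\<^sub>v v) $ j"
      using j X by simp
    thus ?thesis
      using j by (simp add: Xv)
  qed
  have "v \<bullet> v = (\<Sum>i<d. v $ i * (\<Sum>x\<in>B. a x * x $ i))"
    using v lincomb_index[OF _ Bc, of _ a]
    by (simp add: scalar_prod_def lessThan_atLeast0 flip: a)
  also have "\<dots> = (\<Sum>x\<in>B. a x * (\<Sum>i<d. x $ i * v $ i))"
    unfolding sum_distrib_left by (subst sum.swap) (simp add: ac_simps)
  also have "\<dots> = (\<Sum>x\<in>B. a x * (x \<bullet> v))"
    using v by (simp add: scalar_prod_def lessThan_atLeast0)
  also have "\<dots> = 0"
    by (simp add: orth)
  finally show ?thesis
    using conjugate_square_eq_0_vec[OF v] by simp
qed

text \<open>A kernel vector \<open>v\<close> of the Gram matrix satisfies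
  \<open>X\<^sup>T *\<^sub>v v = 0\<^sub>v n\<close>, as the squared length of the left side is
  \<open>v \<bullet> (G *\<^sub>v v)\<close>. So the determinant is nonzero and
  \<open>mat_inverse\<close> returns \<open>Some\<close>, which gives \<open>inv_mat\<close> its
  intended value.\<close>

lemma inv_mat_gram:
  fixes X :: "real mat"
  assumes X: "X \<in> carrier_mat d n" and rank: "vec_space.rank d X = d"
  shows "inv_mat (X * X\<^sup>T) \<in> carrier_mat d d"
    and "X * X\<^sup>T * inv_mat (X * X\<^sup>T) = 1\<^sub>m d"
    and "inv_mat (X * X\<^sup>T) * (X * X\<^sup>T) = 1\<^sub>m d"
    and "(inv_mat (X * X\<^sup>T))\<^sup>T = inv_mat (X * X\<^sup>T)"
proof -
  define G where "G = X * X\<^sup>T"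
  define H where "H = inv_mat G"
  have G: "G \<in> carrier_mat d d" and GT: "G\<^sup>T = G"
    using X by (auto simp: G_def transpose_mult[of _ d n _ d])
  have "det G \<noteq> 0"
  proof
    assume "det G = 0"
    then obtain v where v: "v \<in> carrier_vec d" "v \<noteq> 0\<^sub>v d" and Gv: "G *\<^sub>v v = 0\<^sub>v d"
      using det_0_iff_vec_prod_zero[OF G] by auto
    have Xv: "X\<^sup>T *\<^sub>v v \<in> carrier_vec n"
      using X v by auto
    have "(X\<^sup>T *\<^sub>v v) \<bullet> (X\<^sup>T *\<^sub>v v) = v \<bullet> (X *\<^sub>v (X\<^sup>T *\<^sub>v v))"
      using X v Xv by (intro transpose_vec_mult_scalar)
    also have "X *\<^sub>v (X\<^sup>T *\<^sub>v v) = G *\<^sub>v v"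
      using X v unfolding G_def by (intro assoc_mult_mat_vec[symmetric]) auto
    also have "v \<bullet> (G *\<^sub>v v) = 0"
      using v by (simp add: Gv)
    finally have "X\<^sup>T *\<^sub>v v = 0\<^sub>v n"
      using conjugate_square_eq_0_vec[OF Xv] by simp
    from full_row_rank_left_kernel[OF X rank v(1) this] v(2) show False
      by simp
  qed
  hence "G \<in> Units (ring_mat TYPE(real) d ())"
    by (rule det_non_zero_imp_unit[OF G])
  then obtain B where "mat_inverse G = Some B"
    using mat_inverse(1)[OF G, where b = "()"] by (cases "mat_inverse G") auto
  hence "mat_inverse G = Some H"
    by (simp add: H_def inv_mat_def)
  from mat_inverse(2)[OF G this] have H: "H \<in> carrier_mat d d" and GH: "G * H = 1\<^sub>m d"
    and HG: "H * G = 1\<^sub>m d"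
    by auto
  have "H\<^sup>T = H\<^sup>T * (G * H)"
    using H by (simp add: GH)
  also have "\<dots> = (G * H)\<^sup>T * H"
    using G H by (simp add: transpose_mult[of _ d d _ d] GT assoc_mult_mat[of _ d d _ d _ d])
  also have "\<dots> = H"
    using H by (simp add: GH)
  finally have "H\<^sup>T = H" .
  with H GH HG show "inv_mat (X * X\<^sup>T) \<in> carrier_mat d d"
    and "X * X\<^sup>T * inv_mat (X * X\<^sup>T) = 1\<^sub>m d"
    and "inv_mat (X * X\<^sup>T) * (X * X\<^sup>T) = 1\<^sub>m d"
    and "(inv_mat (X * X\<^sup>T))\<^sup>T = inv_mat (X * X\<^sup>T)"
    by (simp_all add: H_def G_def)
qed

section \<open>Low-rank approximation\<close>

text \<open>The library versions of these laws need all carrier sizes instantiated before the simplifier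
  can apply them; the dimension side conditions below it discharges by itself.\<close>

lemma mult_mat_assoc_dim:
  fixes A B C :: "'a :: comm_ring_1 mat"
  assumes "dim_col A = dim_row B" "dim_col B = dim_row C"
  shows "A * B * C = A * (B * C)"
  using assms by (intro assoc_mult_mat[of _ "dim_row A" "dim_row B" _ "dim_row C" _ "dim_col C"]) auto

lemma transpose_mult_dim:
  fixes A B :: "'a :: comm_ring_1 mat"
  assumes "dim_col A = dim_row B"
  shows "(A * B)\<^sup>T = B\<^sup>T * A\<^sup>T"
  using assms by (intro transpose_mult[of _ "dim_row A" "dim_row B" _ "dim_col B"]) auto

lemma mult_minus_mat_dim:
  fixes A B C :: "'a :: comm_ring_1 mat"
  assumes "dim_col A = dim_row B" "dim_row C = dim_row B" "dim_col C = dim_col B"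
  shows "A * (B - C) = A * B - A * C"
  using assms by (intro mult_minus_distrib_mat[of _ "dim_row A" "dim_row B" _ "dim_col B"]) auto

lemma minus_mult_mat_dim:
  fixes A B C :: "'a :: comm_ring_1 mat"
  assumes "dim_col A = dim_row C" "dim_row A = dim_row B" "dim_col A = dim_col B"
  shows "(A - B) * C = A * C - B * C"
  using assms by (intro minus_mult_distrib_mat[of _ "dim_row A" "dim_col A" _ _ "dim_col C"]) auto

lemma transpose_minus_dim:
  fixes A B :: "'a :: comm_ring_1 mat"
  assumes "dim_row A = dim_row B" "dim_col A = dim_col B"
  shows "(A - B)\<^sup>T = A\<^sup>T - B\<^sup>T"
  using assms by (intro transpose_minus[of _ "dim_row A" "dim_col A"]) auto

lemmas mat_dim_simps = mult_mat_assoc_dim transpose_mult_dim mult_minus_mat_dim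
  minus_mult_mat_dim transpose_minus_dim

section \<open>Equivalence of the factorized least-squares problem with trace maximisation\<close>

theorem proposition3p3:
  fixes d_in d_out n k :: nat
    and a b :: real
    and C :: "real \<Rightarrow> real mat set"
    and Q :: "real mat \<Rightarrow> real mat"
    and W What X Y \<Sigma>1 \<Sigma>2 \<Sigma>3 \<Sigma> :: "real mat"
    and V_of :: "real mat \<Rightarrow> real mat"
    and sol_P sol_Q :: "(real mat \<times> real mat) set"
  assumes "d_in \<ge> 1" and "d_out \<ge> 1" and "n \<ge> max d_in d_out"
    and "1 \<le> k" and "k \<le> min d_in d_out"
    and "a > 0" and "b > 0"
    and "quantization_operator C a Q"
    and "W \<in> carrier_mat d_out d_in"
    and "What \<in> carrier_mat d_out d_in" and "What \<in> C b"
    and "X \<in> carrier_mat d_in n"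
    and full_rank: "vec_space.rank d_in X = d_in"
    and Y: "Y = Q X"
    and \<Sigma>1: "\<Sigma>1 = W * X * X\<^sup>T * W\<^sup>T"
    and \<Sigma>2: "\<Sigma>2 = What * Y * X\<^sup>T * inv_mat (X * X\<^sup>T) * X * Y\<^sup>T * What\<^sup>T"
    and \<Sigma>3: "\<Sigma>3 = What * Y * X\<^sup>T * W\<^sup>T + W * X * Y\<^sup>T * What\<^sup>T"
    and \<Sigma>: "\<Sigma> = \<Sigma>1 + \<Sigma>2 - \<Sigma>3"
    and V_of: "\<And>U. V_of U = (W\<^sup>T - inv_mat (X * X\<^sup>T) * X * Y\<^sup>T * What\<^sup>T) * U"
    and sol_P: "sol_P =
      {s. is_arg_min (\<lambda>(U, V). (frob_norm (W * X - What * Q X - U * V\<^sup>T * X))\<^sup>2)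
            (\<lambda>(U, V). U \<in> carrier_mat d_out k \<and> V \<in> carrier_mat d_in k) s}"
    and sol_Q: "sol_Q =
      {s. is_arg_max (\<lambda>(U, V). trace_mat (U\<^sup>T * \<Sigma> * U))
            (\<lambda>(U, V). U \<in> carrier_mat d_out k \<and> orthonormal_cols U \<and>
                      V \<in> carrier_mat d_in k \<and> V = V_of U) s}"
  shows
    \<comment> \<open>(P) is invariant under (U, V) to (c U, V / c), so it has solutions with U not orthonormal.
        The solution sets agree once U is normalised, and the solutions of (P) are exactly the
        feasible pairs with the same product as a solution of (Q).\<close>
    "sol_Q = {(U, V) \<in> sol_P. orthonormal_cols U} \<and>
     sol_P = {(U, V). U \<in> carrier_mat d_out k \<and> V \<in> carrier_mat d_in k \<and>
                (\<exists>(U', V') \<in> sol_Q. U * V\<^sup>T = U' * V'\<^sup>T)} \<and>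
     (\<exists>U. top_eigenvectors k \<Sigma> U) \<and>
     (\<forall>U. top_eigenvectors k \<Sigma> U \<longrightarrow> (U, V_of U) \<in> sol_P \<and> (U, V_of U) \<in> sol_Q)"
proof -
  define m where "m = d_in"
  define d where "d = d_out"
  define H where "H = inv_mat (X * X\<^sup>T)"
  \<comment> \<open>\<open>A\<close> solves the regression without rank constraint: the rows of
    \<open>N\<close> are the projections of the rows of \<open>W * X - What * Y\<close> onto the row
    space of \<open>X\<close>, and \<open>E\<close> is the residual.\<close>
  define A where "A = W - What * Y * X\<^sup>T * H"
  define N where "N = A * X"
  define E where "E = W * X - What * Q X - N"
  define c where "c = (frob_norm E)\<^sup>2 + (frob_norm N)\<^sup>2"
  define f where "f = (\<lambda>U V. (frob_norm (W * X - What * Q X - U * V\<^sup>T * X))\<^sup>2)"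
  define g where "g = (\<lambda>U. trace_mat (U\<^sup>T * \<Sigma> * U))"
  have W: "W \<in> carrier_mat d m" and What: "What \<in> carrier_mat d m" and X: "X \<in> carrier_mat m n"
    and rank: "vec_space.rank m X = m" and kd: "k \<le> d"
    using assms by (simp_all add: m_def d_def)
  have Yc: "Y \<in> carrier_mat m n"
    using \<open>quantization_operator C a Q\<close> X unfolding Y quantization_operator_def by auto
  note H = inv_mat_gram[OF X rank, folded H_def]
  have A: "A \<in> carrier_mat d m" and N: "N \<in> carrier_mat d n" and E: "E \<in> carrier_mat d n"
    using W What X Yc H by (auto simp: A_def N_def E_def Y[symmetric])
  note dims = carrier_matD[OF W] carrier_matD[OF What] carrier_matD[OF X] carrier_matD[OF Yc]
    carrier_matD[OF H(1)] carrier_matD[OF A] carrier_matD[OF N] carrier_matD[OF E]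
  have XXH: "X * (X\<^sup>T * H) = 1\<^sub>m m"
    using H(2) by (simp add: mult_mat_assoc_dim dims)
  have HXX: "H * (X * X\<^sup>T) = 1\<^sub>m m"
    by (rule H(3))
  \<comment> \<open>Cancellation with a trailing factor \<open>Z\<close>, matching the
    right-associated form that \<open>mat_dim_simps\<close> produces.\<close>
  have HXX': "H * (X * (X\<^sup>T * Z)) = Z" if "dim_row Z = m" for Z
  proof -
    have "H * (X * (X\<^sup>T * Z)) = H * (X * X\<^sup>T) * Z"
      using that by (simp add: mult_mat_assoc_dim dims)
    thus ?thesis
      using that by (simp add: HXX left_mult_one_mat[of _ m "dim_col Z"])
  qed
  have XXH': "X * (X\<^sup>T * (H * Z)) = Z" if "dim_row Z = m" for Z
  proof -
    have "X * (X\<^sup>T * (H * Z)) = X * (X\<^sup>T * H) * Z"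
      using that by (simp add: mult_mat_assoc_dim dims)
    thus ?thesis
      using that by (simp add: XXH left_mult_one_mat[of _ m "dim_col Z"])
  qed
  have V_of_A: "V_of U = A\<^sup>T * U" for U
  proof -
    have "A\<^sup>T = W\<^sup>T - H * X * Y\<^sup>T * What\<^sup>T"
      by (simp add: A_def mat_dim_simps dims H(4))
    thus ?thesis
      by (simp add: V_of H_def)
  qed
  have NN: "\<Sigma> = N * N\<^sup>T"
  proof -
    have "N * N\<^sup>T = W * (X * (X\<^sup>T * W\<^sup>T)) - What * (Y * (X\<^sup>T * W\<^sup>T))
        - (W * (X * (Y\<^sup>T * What\<^sup>T)) - What * (Y * (X\<^sup>T * (H * (X * (Y\<^sup>T * What\<^sup>T))))))"
      by (simp add: N_def A_def mat_dim_simps dims H(4) HXX' XXH')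
    moreover have "\<Sigma> = W * (X * (X\<^sup>T * W\<^sup>T)) + What * (Y * (X\<^sup>T * (H * (X * (Y\<^sup>T * What\<^sup>T)))))
        - (What * (Y * (X\<^sup>T * W\<^sup>T)) + W * (X * (Y\<^sup>T * What\<^sup>T)))"
      by (simp add: \<Sigma> \<Sigma>1 \<Sigma>2 \<Sigma>3 mat_dim_simps dims flip: H_def)
    ultimately show ?thesis
      by (intro eq_matI) (simp_all add: dims)
  qed
  have \<Sigma>c: "\<Sigma> \<in> carrier_mat d d" and \<Sigma>_sym: "\<Sigma>\<^sup>T = \<Sigma>"
    using N by (auto simp: NN transpose_mult_dim)
  have EX: "E * X\<^sup>T = 0\<^sub>m d m"
  proof -
    have "E * X\<^sup>T = W * (X * X\<^sup>T) - What * (Y * X\<^sup>T) - (W * (X * X\<^sup>T) - What * (Y * X\<^sup>T))"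
      by (simp add: E_def N_def A_def mat_dim_simps dims HXX HXX' flip: Y)
    thus ?thesis
      by (auto simp: dims intro!: eq_matI)
  qed
  \<comment> \<open>This holds for every feasible pair: the second summand has \<open>X\<close> as
    right factor, so the cross term contains \<open>E * X\<^sup>T\<close>.\<close>
  have f_split: "f U V = (frob_norm E)\<^sup>2 + (frob_norm (N - U * (V\<^sup>T * X)))\<^sup>2"
    if U: "U \<in> carrier_mat d k" and V: "V \<in> carrier_mat m k" for U V
  proof -
    have "E * (N - U * (V\<^sup>T * X))\<^sup>T = E * (X\<^sup>T * (A - U * V\<^sup>T)\<^sup>T)"
      using U V by (simp add: N_def mat_dim_simps dims)
    also have "\<dots> = E * X\<^sup>T * (A - U * V\<^sup>T)\<^sup>T"
      using U V by (simp add: mult_mat_assoc_dim dims)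
    also have "\<dots> = 0\<^sub>m d d"
      using U A V by (simp add: EX left_mult_zero_mat[of _ m d])
    finally have "trace_mat (E * (N - U * (V\<^sup>T * X))\<^sup>T) = 0"
      by (simp add: trace_mat_def)
    moreover have "N - U * (V\<^sup>T * X) \<in> carrier_mat d n"
      using N U V X by auto
    ultimately have "(frob_norm (E + (N - U * (V\<^sup>T * X))))\<^sup>2 =
        (frob_norm E)\<^sup>2 + (frob_norm (N - U * (V\<^sup>T * X)))\<^sup>2"
      using E by (intro frob_norm_pythagoras)
    moreover have "E + (N - U * (V\<^sup>T * X)) = W * X - What * Q X - U * V\<^sup>T * X"
      using U V by (intro eq_matI) (auto simp: E_def mat_dim_simps dims simp flip: Y)
    ultimately show ?thesis
      by (simp add: f_def)
  qed
  \<comment> \<open>\<open>h\<close> measures how far \<open>V\<close> is from optimal for the given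
    \<open>U\<close>; its zeros encode the constraint of (Q).\<close>
  define h where "h = (\<lambda>U V. (frob_norm (U\<^sup>T * N - V\<^sup>T * X))\<^sup>2)"
  have f_orth: "f U V = c - g U + h U V"
    if U: "U \<in> carrier_mat d k" and V: "V \<in> carrier_mat m k" and oU: "orthonormal_cols U" for U V
  proof -
    have "U\<^sup>T * N \<in> carrier_mat k n"
      using U N by simp
    hence "(frob_norm (U\<^sup>T * N))\<^sup>2 = g U"
      using U by (simp add: frob_norm_sq g_def NN mat_dim_simps dims)
    moreover have "(frob_norm (N - U * (V\<^sup>T * X)))\<^sup>2 =
        (frob_norm N)\<^sup>2 - (frob_norm (U\<^sup>T * N))\<^sup>2 + h U V"
      unfolding h_def using U V X N oU
      by (intro frob_norm_minus_orthonormal) (auto simp: orthonormal_cols_iff)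
    ultimately show ?thesis
      by (simp add: f_split[OF U V] c_def)
  qed
  have h_nonneg: "h U V \<ge> 0" for U V
    by (simp add: h_def)
  have h_0: "h U V = 0 \<longleftrightarrow> V = V_of U"
    if U: "U \<in> carrier_mat d k" and V: "V \<in> carrier_mat m k" for U V
  proof
    assume "V = V_of U"
    hence "U\<^sup>T * N - V\<^sup>T * X = 0\<^sub>m k n"
      using U by (intro eq_matI) (auto simp: V_of_A N_def mat_dim_simps dims)
    thus "h U V = 0"
      by (simp add: h_def frob_norm_zero)
  next
    assume "h U V = 0"
    moreover have "U\<^sup>T * N - V\<^sup>T * X \<in> carrier_mat k n"
      using U V N X by auto
    ultimately have *: "U\<^sup>T * N - V\<^sup>T * X = 0\<^sub>m k n"
      unfolding h_def using frob_norm_eq_0D by blast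
    \<comment> \<open>\<open>X\<^sup>T * H\<close> is a right inverse of \<open>X\<close>, so the
      factor \<open>X\<close> can be cancelled.\<close>
    have "U\<^sup>T * A - V\<^sup>T = (U\<^sup>T * A - V\<^sup>T) * (X * (X\<^sup>T * H))"
      using U V A by (simp add: XXH right_mult_one_mat[of _ k m])
    also have "\<dots> = (U\<^sup>T * N - V\<^sup>T * X) * (X\<^sup>T * H)"
      using U V by (simp add: N_def mat_dim_simps dims)
    also have "\<dots> = 0\<^sub>m k m"
      using X H(1) by (simp add: * left_mult_zero_mat[of _ n m])
    finally have **: "U\<^sup>T * A - V\<^sup>T = 0\<^sub>m k m" .
    show "V = V_of U"
    proof (rule eq_matI)
      fix i j assume "i < dim_row (V_of U)" "j < dim_col (V_of U)"
      hence ij: "i < m" "j < k"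
        using U A by (auto simp: V_of_A)
      have "(U\<^sup>T * A - V\<^sup>T) $$ (j, i) = 0"
        using ij by (simp add: **)
      moreover have "(U\<^sup>T * A) $$ (j, i) = (A\<^sup>T * U) $$ (i, j)"
        using ij U A by (simp add: comm_scalar_prod[of _ d])
      ultimately show "V $$ (i, j) = V_of U $$ (i, j)"
        using ij U V A by (simp add: V_of_A)
    qed (use U V A in \<open>auto simp: V_of_A\<close>)
  qed
  have V_of_carrier: "V_of U \<in> carrier_mat m k" if "U \<in> carrier_mat d k" for U
    using that A by (auto simp: V_of_A)
  \<comment> \<open>The objective sees only the product, which permits replacing any pair by one
    with orthonormal \<open>U'\<close>.\<close>
  have f_cong: "f U V = f U' V'" if "U * V\<^sup>T = U' * V'\<^sup>T" for U V U' V'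
    using that by (simp add: f_def)
  have orth_ex: "\<exists>U' V'. U' \<in> carrier_mat d k \<and> V' \<in> carrier_mat m k \<and> orthonormal_cols U' \<and>
      U * V\<^sup>T = U' * V'\<^sup>T"
    if U: "U \<in> carrier_mat d k" and V: "V \<in> carrier_mat m k" for U V
  proof -
    obtain P B where P: "P \<in> carrier_mat d k" "P\<^sup>T * P = 1\<^sub>m k" and B: "B \<in> carrier_mat k k"
      and UPB: "U = P * B"
      using orthonormal_factorization[OF U kd] by auto
    have "U * V\<^sup>T = P * (V * B\<^sup>T)\<^sup>T"
      using P B V by (simp add: UPB mat_dim_simps)
    moreover have "V * B\<^sup>T \<in> carrier_mat m k"
      using B V by auto
    ultimately show ?thesis
      using P orthonormal_cols_iff[OF P(1)] by blast
  qed
  have top_exists: "\<exists>T. top_eigenvectors k \<Sigma> T"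
    by (rule top_eigenvectors_exist[OF \<Sigma>c \<Sigma>_sym kd])
  have topD: "T \<in> carrier_mat d k" "orthonormal_cols T"
    "\<And>U. U \<in> carrier_mat d k \<Longrightarrow> orthonormal_cols U \<Longrightarrow> g U \<le> g T"
    if "top_eigenvectors k \<Sigma> T" for T
    using that top_eigenvectors_maximal[OF \<Sigma>c \<Sigma>_sym kd that] \<Sigma>c
    by (auto simp: top_eigenvectors_def g_def)
  \<comment> \<open>\<open>T\<close> is a reference optimum: \<open>g T\<close> is the maximum of
    (Q), and \<open>c - g T\<close> will be the minimum of (P).\<close>
  obtain T where T: "top_eigenvectors k \<Sigma> T"
    using top_exists by auto
  note T' = topD[OF T]
  \<comment> \<open>After normalising the pair, the bound follows from \<open>g U' \<le> g T\<close>
    and \<open>h U' V' \<ge> 0\<close>.\<close>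
  have f_lower: "c - g T \<le> f U V" if UV: "U \<in> carrier_mat d k" "V \<in> carrier_mat m k" for U V
  proof -
    obtain U' V' where U': "U' \<in> carrier_mat d k" "orthonormal_cols U'"
      and V': "V' \<in> carrier_mat m k" and eq: "U * V\<^sup>T = U' * V'\<^sup>T"
      using orth_ex[OF UV] by auto
    have "f U V = c - g U' + h U' V'"
      using f_cong[OF eq] f_orth[OF U'(1) V' U'(2)] by simp
    thus ?thesis
      using T'(3)[OF U'] h_nonneg[of U' V'] by simp
  qed
  have f_T: "f T (V_of T) = c - g T"
    using f_orth[OF T'(1) V_of_carrier[OF T'(1)] T'(2)] h_0[OF T'(1) V_of_carrier[OF T'(1)]] by simp
  have in_P: "(U, V) \<in> sol_P \<longleftrightarrow>
      U \<in> carrier_mat d k \<and> V \<in> carrier_mat m k \<and> f U V = c - g T" for U V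
  proof -
    have "(U, V) \<in> sol_P \<longleftrightarrow> U \<in> carrier_mat d k \<and> V \<in> carrier_mat m k \<and>
        (\<forall>U' V'. U' \<in> carrier_mat d k \<longrightarrow> V' \<in> carrier_mat m k \<longrightarrow> f U V \<le> f U' V')"
      unfolding sol_P m_def d_def f_def by (auto simp: is_arg_min_def not_less)
    thus ?thesis
      using f_lower f_T T'(1) V_of_carrier by (metis order_antisym)
  qed
  have in_Q: "(U, V) \<in> sol_Q \<longleftrightarrow>
      U \<in> carrier_mat d k \<and> orthonormal_cols U \<and> V = V_of U \<and> g U = g T" for U V
  proof -
    have "(U, V) \<in> sol_Q \<longleftrightarrow> U \<in> carrier_mat d k \<and> orthonormal_cols U \<and> V \<in> carrier_mat m k \<and>
        V = V_of U \<and> (\<forall>U'. U' \<in> carrier_mat d k \<longrightarrow> orthonormal_cols U' \<longrightarrow> g U' \<le> g U)"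
      using V_of_carrier unfolding sol_Q m_def d_def g_def by (auto simp: is_arg_max_def not_less)
    thus ?thesis
      using T' V_of_carrier by (metis order_antisym)
  qed
  \<comment> \<open>For orthonormal \<open>U\<close>, the value \<open>c - g U + h U V\<close>
    equals \<open>c - g T\<close> only if \<open>g U = g T\<close> and \<open>h U V = 0\<close>,
    since neither term can compensate the other.\<close>
  have Q_iff: "(U, V) \<in> sol_Q \<longleftrightarrow> (U, V) \<in> sol_P \<and> orthonormal_cols U" for U V
  proof (cases "U \<in> carrier_mat d k \<and> V \<in> carrier_mat m k \<and> orthonormal_cols U")
    case True
    hence "f U V = c - g U + h U V" "g U \<le> g T" "h U V = 0 \<longleftrightarrow> V = V_of U"
      using f_orth T'(3) h_0 by auto
    with True h_nonneg[of U V] show ?thesis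
      by (auto simp: in_P in_Q)
  qed (use V_of_carrier in \<open>auto simp: in_P in_Q\<close>)
  have P_iff: "(U, V) \<in> sol_P \<longleftrightarrow> U \<in> carrier_mat d k \<and> V \<in> carrier_mat m k \<and>
      (\<exists>(U', V')\<in>sol_Q. U * V\<^sup>T = U' * V'\<^sup>T)" for U V
  proof
    assume P: "(U, V) \<in> sol_P"
    hence UV: "U \<in> carrier_mat d k" "V \<in> carrier_mat m k"
      by (auto simp: in_P)
    obtain U' V' where "U' \<in> carrier_mat d k" "orthonormal_cols U'" "V' \<in> carrier_mat m k"
      and eq: "U * V\<^sup>T = U' * V'\<^sup>T"
      using orth_ex[OF UV] by auto
    hence "(U', V') \<in> sol_Q"
      using P f_cong[OF eq] by (auto simp: Q_iff in_P)
    with UV eq show "U \<in> carrier_mat d k \<and> V \<in> carrier_mat m k \<and>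
        (\<exists>(U', V')\<in>sol_Q. U * V\<^sup>T = U' * V'\<^sup>T)"
      by blast
  next
    assume "U \<in> carrier_mat d k \<and> V \<in> carrier_mat m k \<and> (\<exists>(U', V')\<in>sol_Q. U * V\<^sup>T = U' * V'\<^sup>T)"
    then obtain U' V' where UV: "U \<in> carrier_mat d k" "V \<in> carrier_mat m k"
      and Q: "(U', V') \<in> sol_Q" and eq: "U * V\<^sup>T = U' * V'\<^sup>T"
      by blast
    show "(U, V) \<in> sol_P"
      using UV Q f_cong[OF eq] by (simp add: Q_iff in_P)
  qed
  \<comment> \<open>\<open>U\<close> and \<open>T\<close> are both maximal, so each bounds the other
    and \<open>g U = g T\<close>, even for repeated eigenvalues.\<close>
  have top_Q: "(U, V_of U) \<in> sol_Q" if "top_eigenvectors k \<Sigma> U" for U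
    using topD[OF that] T' by (auto simp: in_Q intro: order_antisym)
  have "sol_Q = {(U, V) \<in> sol_P. orthonormal_cols U}"
    by (auto simp: Q_iff)
  moreover have "sol_P = {(U, V). U \<in> carrier_mat d_out k \<and> V \<in> carrier_mat d_in k \<and>
      (\<exists>(U', V') \<in> sol_Q. U * V\<^sup>T = U' * V'\<^sup>T)}"
    unfolding d_def[symmetric] m_def[symmetric] set_eq_iff split_paired_All by (simp add: P_iff)
  ultimately show ?thesis
    using top_exists top_Q by (simp add: Q_iff)
qed

end
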